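(* Let $r\in\mathbb{N}$, and let $n_1,\ldots,n_r\ge 3$ be odd integers. Let $G:=\operatorname{Sym}(n_1)\wr\ldots\wr\operatorname{Sym}(n_r)$ be the iterated wreath product of symmetric groups of degrees $n_1,\ldots,n_r$. Then there exists a binary cyclic code $\mathcal{C}$ of length $N:=n_1\cdots n_r$ such that $\operatorname{Aut}(\mathcal{C})\cong G$.
   Context: $\mathbb{N}$ denotes the positive integers. A binary linear code of length $N$ is a linear subspace $\mathcal{C}$ of $\mathbb{F}_2^N$. The symmetric group $\operatorname{Sym}(N)$ acts on $\mathbb{F}_2^N$ by coordinate permutations, and $\operatorname{Aut}(\mathcal{C})\le\operatorname{Sym}(N)$ is the subgroup of all permutations mapping the subspace $\mathcal{C}$ into itself. The code $\mathcal{C}$ is called cyclic if $\operatorname{Aut}(\mathcal{C})$ contains a regular cycle of length $N$ (i.e. an $N$-cycle). Wreath product convention: for a group $H$ and $n\in\mathbb{N}$, $H\wr\operatorname{Sym}(n)=\operatorname{Sym}(n)\ltimes H^n$ where the top group $\operatorname{Sym}(n)$ permutes the $n$ coordinates of the base group $H^n$. The iterated wreath product is formed recursively as $\operatorname{Sym}(n_1)\wr\ldots\wr\operatorname{Sym}(n_r)=(\operatorname{Sym}(n_1)\wr\ldots\wr\operatorname{Sym}(n_{r-1}))\wr\operatorname{Sym}(n_r)$. *)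

theory Defs
  imports
    Complex_Main
    "HOL-Library.Z2"
    "HOL-Library.Function_Algebras"
    "HOL-Algebra.Product_Groups"
    "HOL-Algebra.Sym_Groups"
    "HOL-Algebra.Weak_Morphisms"
begin

section \<open>Binary linear codes and their automorphism groups\<close>

text \<open>
  The space \<open>F\<^sub>2\<^sup>N\<close> is the set of functions \<open>nat \<Rightarrow> bit\<close> that vanish outside the index set
  \<open>{1..N}\<close> on which \<^const>\<open>sym_group\<close> acts. Vectors are added pointwise, by the
  function instances of \<^theory>\<open>HOL-Library.Function_Algebras\<close>.
\<close>

definition words :: "nat \<Rightarrow> (nat \<Rightarrow> bit) set" where
  "words N = {v. \<forall>i. i \<notin> {1..N} \<longrightarrow> v i = 0}"

global_interpretation F2: vector_space "\<lambda>(c :: bit) (v :: nat \<Rightarrow> bit) i. c * v i"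
  by unfold_locales (auto simp: fun_eq_iff algebra_simps)

definition linear_code :: "nat \<Rightarrow> (nat \<Rightarrow> bit) set \<Rightarrow> bool" where
  "linear_code N C \<longleftrightarrow> C \<subseteq> words N \<and> F2.subspace C"

text \<open>The left action: the entry of \<open>v\<close> at position \<open>i\<close> is moved to position \<open>p i\<close>.\<close>

definition permute_word :: "(nat \<Rightarrow> nat) \<Rightarrow> (nat \<Rightarrow> bit) \<Rightarrow> nat \<Rightarrow> bit" where
  "permute_word p v = v \<circ> inv' p"

definition code_Aut :: "nat \<Rightarrow> (nat \<Rightarrow> bit) set \<Rightarrow> (nat \<Rightarrow> nat) monoid" where
  "code_Aut N C =
     (sym_group N)\<lparr>carrier := {p \<in> carrier (sym_group N). permute_word p ` C \<subseteq> C}\<rparr>"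

definition cyclic_code :: "nat \<Rightarrow> (nat \<Rightarrow> bit) set \<Rightarrow> bool" where
  "cyclic_code N C \<longleftrightarrow> linear_code N C \<and>
     (\<exists>cs. cycle cs \<and> set cs = {1..N} \<and> cycle_of_list cs \<in> carrier (code_Aut N C))"

lemma finite_words: "finite (words N)"
proof -
  have "finite (UNIV :: bit set)"
    by (rule finite_subset[of _ "{0, 1}"]) auto
  then have "finite {v :: nat \<Rightarrow> bit. \<forall>i. (i \<in> {1..N} \<longrightarrow> v i \<in> UNIV) \<and> (i \<notin> {1..N} \<longrightarrow> v i = 0)}"
    by (intro finite_set_of_finite_funs) auto
  then show ?thesis by (simp add: words_def)
qed

lemma code_Aut_is_subgroup:
  assumes "linear_code N C"
  shows "subgroup (carrier (code_Aut N C)) (sym_group N)"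
proof -
  interpret group "sym_group N" by (rule sym_group_is_group)
  have comp: "permute_word (p \<circ> q) v = permute_word p (permute_word q v)"
    if "p permutes {1..N}" "q permutes {1..N}" for p q v
    using that by (simp add: permute_word_def o_inv_distrib permutes_bij o_assoc)
  have id: "permute_word id v = v" for v
    by (simp add: permute_word_def)
  have finC: "finite C"
    using assms finite_words by (auto simp: linear_code_def intro: finite_subset)
  show ?thesis
  proof (rule subgroupI)
    have "id \<in> carrier (code_Aut N C)"
      by (auto simp: code_Aut_def sym_group_carrier id permutes_id)
    then show "carrier (code_Aut N C) \<noteq> {}" by blast
  next
    show "carrier (code_Aut N C) \<subseteq> carrier (sym_group N)"
      by (auto simp: code_Aut_def)
  next
    fix p q assume "p \<in> carrier (code_Aut N C)" "q \<in> carrier (code_Aut N C)"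
    then show "p \<otimes>\<^bsub>sym_group N\<^esub> q \<in> carrier (code_Aut N C)"
      by (auto simp: code_Aut_def sym_group_carrier sym_group_mult permutes_compose comp)
  next
    fix p assume p: "p \<in> carrier (code_Aut N C)"
    then have per: "p permutes {1..N}" and sub: "permute_word p ` C \<subseteq> C"
      by (auto simp: code_Aut_def sym_group_carrier)
    have per': "inv' p permutes {1..N}" using per by (rule permutes_inv)
    have undo: "permute_word (inv' p) (permute_word p v) = v" for v
      using comp[OF per' per, of v] permutes_inv_o(2)[OF per] by (simp add: id)
    have "inj_on (permute_word p) C" by (metis undo inj_onI)
    then have "permute_word p ` C = C" using endo_inj_surj[OF finC sub] by blast
    then have "permute_word (inv' p) ` C \<subseteq> C" using undo by (metis imageE image_subsetI)
    moreover have "inv\<^bsub>sym_group N\<^esub> p = inv' p"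
      using per per' permutes_inv_o(2)[OF per]
      by (intro inv_equality) (auto simp: sym_group_def)
    ultimately show "inv\<^bsub>sym_group N\<^esub> p \<in> carrier (code_Aut N C)"
      using per' by (simp add: code_Aut_def sym_group_carrier)
  qed
qed

section \<open>Iterated wreath products of symmetric groups\<close>

text \<open>
  \<open>Sym(n) \<ltimes> H\<^sup>n\<close>: the pair \<open>(p, f)\<close> stands for \<open>p f\<close> with \<open>p\<close> in the top group and \<open>f\<close> in the base
  group, so \<open>(p f) (q g) = (p q) (q\<^sup>-\<^sup>1 f q) g\<close>, where the coordinate of \<open>q\<^sup>-\<^sup>1 f q\<close> at \<open>i\<close> is
  \<open>f (q i)\<close>.
\<close>

definition wreath_sym :: "('a, 'b) monoid_scheme \<Rightarrow> nat \<Rightarrow> ((nat \<Rightarrow> nat) \<times> (nat \<Rightarrow> 'a)) monoid" where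
  "wreath_sym H n =
     \<lparr>carrier = carrier (sym_group n) \<times> carrier (product_group {1..n} (\<lambda>_. H)),
      monoid.mult = (\<lambda>(p, f) (q, g).
        (p \<otimes>\<^bsub>sym_group n\<^esub> q, (\<lambda>i\<in>{1..n}. f (q i)) \<otimes>\<^bsub>product_group {1..n} (\<lambda>_. H)\<^esub> g)),
      one = (\<one>\<^bsub>sym_group n\<^esub>, \<one>\<^bsub>product_group {1..n} (\<lambda>_. H)\<^esub>)\<rparr>"

lemma wreath_sym_is_group:
  assumes "group H"
  shows "group (wreath_sym H n)"
proof -
  interpret H: group H by fact
  have P: "q i \<in> {1..n} \<longleftrightarrow> i \<in> {1..n}" if "q permutes {1..n}" for q i
    using that by (rule permutes_in_image)
  show ?thesis
  proof (rule groupI)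
    fix x y assume "x \<in> carrier (wreath_sym H n)" "y \<in> carrier (wreath_sym H n)"
    then show "x \<otimes>\<^bsub>wreath_sym H n\<^esub> y \<in> carrier (wreath_sym H n)"
      using P by (fastforce simp: wreath_sym_def sym_group_def permutes_compose PiE_iff split: prod.splits)
  next
    show "\<one>\<^bsub>wreath_sym H n\<^esub> \<in> carrier (wreath_sym H n)"
      by (auto simp: wreath_sym_def sym_group_def permutes_id)
  next
    fix x y z
    assume "x \<in> carrier (wreath_sym H n)" "y \<in> carrier (wreath_sym H n)" "z \<in> carrier (wreath_sym H n)"
    then show "x \<otimes>\<^bsub>wreath_sym H n\<^esub> y \<otimes>\<^bsub>wreath_sym H n\<^esub> z =
        x \<otimes>\<^bsub>wreath_sym H n\<^esub> (y \<otimes>\<^bsub>wreath_sym H n\<^esub> z)"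
      using P by (fastforce simp: wreath_sym_def sym_group_def PiE_iff fun_eq_iff H.m_assoc)
  next
    fix x assume x: "x \<in> carrier (wreath_sym H n)"
    then show "\<one>\<^bsub>wreath_sym H n\<^esub> \<otimes>\<^bsub>wreath_sym H n\<^esub> x = x"
      using P by (fastforce simp: wreath_sym_def sym_group_def PiE_iff extensional_def fun_eq_iff)
    obtain p f where pf: "x = (p, f)" "p permutes {1..n}" "f \<in> {1..n} \<rightarrow>\<^sub>E carrier H"
      using x by (auto simp: wreath_sym_def sym_group_def)
    let ?y = "(inv' p, \<lambda>i\<in>{1..n}. inv\<^bsub>H\<^esub> f (inv' p i))"
    have inv: "inv' p permutes {1..n}" using pf(2) by (rule permutes_inv)
    have "?y \<in> carrier (wreath_sym H n)"
      using pf inv P[OF inv] by (auto simp: wreath_sym_def sym_group_def PiE_iff)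
    moreover have "?y \<otimes>\<^bsub>wreath_sym H n\<^esub> x = \<one>\<^bsub>wreath_sym H n\<^esub>"
      using pf P[OF pf(2)] permutes_inverses[OF pf(2)]
      by (auto simp: wreath_sym_def sym_group_def PiE_iff fun_eq_iff permutes_inv_o)
    ultimately show "\<exists>y\<in>carrier (wreath_sym H n). y \<otimes>\<^bsub>wreath_sym H n\<^esub> x = \<one>\<^bsub>wreath_sym H n\<^esub>"
      by blast
  qed
qed

text \<open>
  Each application of \<^const>\<open>wreath_sym\<close> changes the type of the group elements. To iterate a
  variable number of times, the elements are renamed along injective constructors into one type.
\<close>

datatype wreath_elem = Sym "nat \<Rightarrow> nat" | Wreath "nat \<Rightarrow> nat" "nat \<Rightarrow> wreath_elem"

definition iterated_wreath :: "nat list \<Rightarrow> wreath_elem monoid" where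
  "iterated_wreath ns =
     foldl (\<lambda>H n. image_group (case_prod Wreath) (wreath_sym H n))
       (image_group Sym (sym_group (hd ns))) (tl ns)"

lemma image_group_inj:
  assumes "group G" "inj f"
  shows "group (image_group f G)" "G \<cong> image_group f G"
proof -
  interpret group G by fact
  have i: "inj_on f (carrier G)" using assms(2) by (rule inj_on_subset) simp
  have "f \<in> iso G (image_group f G)"
    using i by (auto simp: iso_def hom_def bij_betw_def image_group_def)
  then show "G \<cong> image_group f G" by (auto simp: is_iso_def)
  have "group ((image_group f G)\<lparr>one := f \<one>\<^bsub>G\<^esub>\<rparr>)"
    using \<open>f \<in> iso G (image_group f G)\<close> by (rule iso_imp_img_group)
  then show "group (image_group f G)" by (simp add: image_group_def)
qed

lemma inj_Sym: "inj Sym" and inj_Wreath: "inj (case_prod Wreath)"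
  by (auto simp: inj_def)

lemma iterated_wreath_is_group: "group (iterated_wreath ns)"
proof -
  have "group (foldl (\<lambda>H n. image_group (case_prod Wreath) (wreath_sym H n)) H ms)"
    if "group H" for H and ms :: "nat list"
    using that
    by (induction ms arbitrary: H) (auto intro: image_group_inj wreath_sym_is_group inj_Wreath)
  then show ?thesis
    unfolding iterated_wreath_def by (simp add: image_group_inj sym_group_is_group inj_Sym)
qed

lemma iterated_wreath_single: "sym_group n \<cong> iterated_wreath [n]"
  by (simp add: iterated_wreath_def image_group_inj sym_group_is_group inj_Sym)

lemma iterated_wreath_snoc:
  "ns \<noteq> [] \<Longrightarrow> wreath_sym (iterated_wreath ns) n \<cong> iterated_wreath (ns @ [n])"
  using image_group_inj(2)[OF wreath_sym_is_group[OF iterated_wreath_is_group] inj_Wreath, of ns n]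
  by (simp add: iterated_wreath_def)

end

theory Submission
  imports Defs
begin

text \<open>
  Order the points into nested blocks, with \<open>n\<^sub>1\<close> points in each innermost block, \<open>n\<^sub>2\<close> innermost
  blocks in each block of the next level, and so on. The iterated wreath product is the group of
  all permutations of the points that respect every level. Taking residue classes modulo
  \<open>n\<^sub>j\<cdots>n\<^sub>r\<close> for the blocks makes the cycle \<open>i \<mapsto> i + 1\<close> one of these permutations
  (\<open>cycle_in_tower\<close>), so it remains to find a code whose automorphisms are exactly these
  permutations.

  Let \<open>D\<close> be a code of length \<open>M\<close>, and replace every coordinate by a block of \<open>n \<ge> 3\<close> coordinates.
  There are two natural codes over \<open>D\<close>: the words that repeat a word of \<open>D\<close> on the blocks
  (\<open>pullback\<close>), and the words whose vector of block sums lies in \<open>D\<close> (\<open>sum_preimage\<close>). Duality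
  exchanges the two: the dual of the pullback of \<open>D\<close> is the preimage of the dual of \<open>D\<close>. A
  permutation that respects the blocks is an automorphism of either code if and only if the induced
  permutation is an automorphism of \<open>D\<close>. Moreover the blocks can be recovered from the code. In the
  pullback, two coordinates lie in one block if and only if all words agree on them, provided that
  distinct coordinates of \<open>D\<close> are told apart by some word. In the preimage, two coordinates lie
  in one block if and only if the word supported on just these two belongs to the code, provided
  that \<open>D\<close> has no word of weight 2. Hence in both cases every automorphism respects the blocks, and
  the automorphism group is the full group of lifts of that of \<open>D\<close> (\<open>word_perms_pullback\<close>,
  \<open>word_perms_sum_preimage\<close>).

  Since a block has at least three elements, a pullback has no word of weight 2 and a preimage tells
  its coordinates apart. The two constructions can therefore be alternated, starting at length 1
  (\<open>code_pair_exists\<close>): this adds the innermost level of blocks at each step and gives exactly the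
  permutations that respect all levels (\<open>lift_tower\<close>). Peeling off the outermost level instead
  identifies the same group with the iterated wreath product
  (\<open>tower_group_iso_iterated_wreath\<close>).
\<close>

section \<open>Linear codes and their permutations\<close>

lemma linear_code_iff:
  "linear_code N C \<longleftrightarrow> C \<subseteq> words N \<and> 0 \<in> C \<and> (\<forall>v\<in>C. \<forall>w\<in>C. v + w \<in> C)"
proof -
  have "(\<lambda>i. c * v i) = (if c = 0 then 0 else v)" for c and v :: "nat \<Rightarrow> bit"
    by (cases c) (simp_all add: fun_eq_iff)
  then show ?thesis unfolding linear_code_def F2.subspace_def by auto
qed

definition word_perms :: "nat \<Rightarrow> (nat \<Rightarrow> bit) set \<Rightarrow> (nat \<Rightarrow> nat) set" where
  "word_perms N C = {p. p permutes {1..N} \<and> permute_word p ` C \<subseteq> C}"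

lemma carrier_code_Aut: "carrier (code_Aut N C) = word_perms N C"
  by (auto simp: code_Aut_def word_perms_def sym_group_carrier)

lemma word_perms_inv:
  assumes "linear_code N C" "p \<in> word_perms N C"
  shows "inv' p \<in> word_perms N C"
proof -
  have p: "p \<in> carrier (sym_group N)"
    using assms(2) by (simp add: word_perms_def sym_group_carrier)
  then have "inv\<^bsub>sym_group N\<^esub> p \<in> carrier (code_Aut N C)"
    using subgroup.m_inv_closed[OF code_Aut_is_subgroup[OF assms(1)], of p] assms(2)
    by (simp add: carrier_code_Aut)
  then show ?thesis using p by (simp add: carrier_code_Aut sym_group_inv_equality)
qed

lemma permute_word_words:
  assumes "p permutes {1..N}" "v \<in> words N"
  shows "permute_word p v \<in> words N"
  using assms permutes_in_image[OF permutes_inv[OF assms(1)]]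
  by (auto simp: words_def permute_word_def)

text \<open>
  For \<open>i \<noteq> k\<close> this is the word of weight 2 supported on \<open>{i, k}\<close>. Defining it as a sum makes it vanish
  for \<open>i = k\<close>, which is the value that block sums give when both coordinates lie in one block.
\<close>

definition pair_word :: "nat \<Rightarrow> nat \<Rightarrow> nat \<Rightarrow> bit" where
  "pair_word i k = (\<lambda>j. of_bool (j = i) + of_bool (j = k))"

lemma permute_pair_word:
  assumes "p permutes A"
  shows "permute_word p (pair_word i k) = pair_word (p i) (p k)"
proof -
  have "inv' p j = i \<longleftrightarrow> j = p i" for i j
    using permutes_inv_eq[OF assms] by metis
  then show ?thesis by (simp add: permute_word_def pair_word_def fun_eq_iff)
qed

definition separating :: "nat \<Rightarrow> (nat \<Rightarrow> bit) set \<Rightarrow> bool" where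
  "separating N C \<longleftrightarrow> (\<forall>i\<in>{1..N}. \<forall>k\<in>{1..N}. i \<noteq> k \<longrightarrow> (\<exists>v\<in>C. v i \<noteq> v k))"

definition pair_free :: "nat \<Rightarrow> (nat \<Rightarrow> bit) set \<Rightarrow> bool" where
  "pair_free N C \<longleftrightarrow> (\<forall>i\<in>{1..N}. \<forall>k\<in>{1..N}. i \<noteq> k \<longrightarrow> pair_word i k \<notin> C)"

section \<open>Codes over a system of blocks\<close>

locale block_projection =
  fixes N M :: nat and block :: "nat \<Rightarrow> nat"
  assumes block_range: "\<And>i. i \<in> {1..N} \<Longrightarrow> block i \<in> {1..M}"
    and block_size: "\<And>b. b \<in> {1..M} \<Longrightarrow> 3 \<le> card {i \<in> {1..N}. block i = b}"
begin

lemma third_in_block: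
  assumes "i \<in> {1..N}"
  obtains l where "l \<in> {1..N}" "block l = block i" "l \<noteq> i" "l \<noteq> k"
proof -
  let ?F = "{l \<in> {1..N}. block l = block i}"
  have "card ?F - card {i, k} \<le> card (?F - {i, k})"
    by (rule diff_card_le_card_Diff) simp
  moreover have "card {i, k} \<le> 2" by (simp add: card_insert_if)
  ultimately have "card (?F - {i, k}) \<noteq> 0"
    using block_size[OF block_range[OF assms]] by linarith
  then have "?F - {i, k} \<noteq> {}" by (metis card.empty)
  then show thesis using that by blast
qed

lemma block_image: "block ` {1..N} = {1..M}"
proof
  show "{1..M} \<subseteq> block ` {1..N}"
  proof
    fix b assume "b \<in> {1..M}"
    then have "{i \<in> {1..N}. block i = b} \<noteq> {}"
      using block_size[of b] by (metis card.empty not_numeral_le_zero)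
    then show "b \<in> block ` {1..N}" by blast
  qed
qed (use block_range in auto)

definition covers :: "(nat \<Rightarrow> nat) \<Rightarrow> (nat \<Rightarrow> nat) \<Rightarrow> bool" where
  "covers p q \<longleftrightarrow> (\<forall>i\<in>{1..N}. block (p i) = q (block i))"

definition preserves_blocks :: "(nat \<Rightarrow> nat) \<Rightarrow> bool" where
  "preserves_blocks p \<longleftrightarrow>
     (\<forall>i\<in>{1..N}. \<forall>k\<in>{1..N}. block (p i) = block (p k) \<longleftrightarrow> block i = block k)"

definition lift :: "(nat \<Rightarrow> nat) set \<Rightarrow> (nat \<Rightarrow> nat) set" where
  "lift Q = {p. p permutes {1..N} \<and> (\<exists>q\<in>Q. covers p q)}"

lemma covers_inv:
  assumes "p permutes {1..N}" "q permutes {1..M}" "covers p q" "i \<in> {1..N}"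
  shows "block (inv' p i) = inv' q (block i)"
proof -
  have "inv' p i \<in> {1..N}"
    using assms(1,4) by (simp only: permutes_in_image[OF permutes_inv])
  then have "block (p (inv' p i)) = q (block (inv' p i))"
    using assms(3) by (auto simp: covers_def)
  then show ?thesis
    using permutes_inverses[OF assms(1)] permutes_inverses[OF assms(2)] by simp
qed

text \<open>
  The induced map on blocks is read off from one representative of each block.
\<close>

lemma preserves_blocks_imp_covers:
  assumes p: "p permutes {1..N}" and pres: "preserves_blocks p"
  obtains q where "q permutes {1..M}" "covers p q"
proof -
  define s where "s = inv_into {1..N} block"
  have s: "s b \<in> {1..N}" "block (s b) = b" if "b \<in> {1..M}" for b
    using that inv_into_into[of b block "{1..N}"] f_inv_into_f[of b block "{1..N}"]
    by (simp_all only: s_def block_image)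
  define q where "q b = (if b \<in> {1..M} then block (p (s b)) else b)" for b
  have pN: "p i \<in> {1..N}" if "i \<in> {1..N}" for i
    using that by (simp only: permutes_in_image[OF p])
  have cov: "covers p q"
    unfolding covers_def
  proof
    fix i assume i: "i \<in> {1..N}"
    have "block (p i) = block (p (s (block i)))"
      using pres i s[OF block_range[OF i]] by (auto simp: preserves_blocks_def)
    then show "block (p i) = q (block i)" using block_range[OF i] by (simp add: q_def)
  qed
  have "q ` {1..M} \<subseteq> {1..M}"
    using s pN block_range by (auto simp: q_def)
  moreover have "inj_on q {1..M}"
  proof (rule inj_onI)
    fix b c assume bc: "b \<in> {1..M}" "c \<in> {1..M}" "q b = q c"
    then have "block (p (s b)) = block (p (s c))" by (simp add: q_def)
    then have "block (s b) = block (s c)"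
      using pres s(1)[OF bc(1)] s(1)[OF bc(2)] unfolding preserves_blocks_def by blast
    then show "b = c" using s(2) bc by simp
  qed
  ultimately have "bij_betw q {1..M} {1..M}"
    by (simp add: bij_betw_def endo_inj_surj)
  then have "q permutes {1..M}" by (rule bij_imp_permutes) (simp only: q_def if_False)
  then show thesis using that cov by blast
qed

lemma covers_imp_preserves_blocks:
  assumes "q permutes {1..M}" "covers p q"
  shows "preserves_blocks p"
  using assms permutes_inj[OF assms(1)] by (auto simp: preserves_blocks_def covers_def inj_eq)

definition pullback :: "(nat \<Rightarrow> bit) set \<Rightarrow> (nat \<Rightarrow> bit) set" where
  "pullback D = {v \<in> words N. \<exists>y\<in>D. \<forall>i\<in>{1..N}. v i = y (block i)}"

definition block_sums :: "(nat \<Rightarrow> bit) \<Rightarrow> nat \<Rightarrow> bit" where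
  "block_sums v b = (\<Sum>i | i \<in> {1..N} \<and> block i = b. v i)"

definition sum_preimage :: "(nat \<Rightarrow> bit) set \<Rightarrow> (nat \<Rightarrow> bit) set" where
  "sum_preimage D = {v \<in> words N. block_sums v \<in> D}"

lemma linear_pullback:
  assumes "linear_code M D"
  shows "linear_code N (pullback D)"
  unfolding linear_code_iff
proof (intro conjI ballI)
  show "pullback D \<subseteq> words N" by (auto simp: pullback_def)
  have "0 \<in> D" using assms by (simp only: linear_code_iff)
  then show "0 \<in> pullback D" unfolding pullback_def words_def by (auto intro!: bexI[of _ 0])
  fix v w assume "v \<in> pullback D" "w \<in> pullback D"
  then obtain y z where "v \<in> words N" "w \<in> words N" "y \<in> D" "z \<in> D"
    "\<forall>i\<in>{1..N}. v i = y (block i)" "\<forall>i\<in>{1..N}. w i = z (block i)"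
    by (auto simp: pullback_def)
  then have "v + w \<in> words N" "y + z \<in> D" "\<forall>i\<in>{1..N}. (v + w) i = (y + z) (block i)"
    using assms by (auto simp: linear_code_iff words_def)
  then show "v + w \<in> pullback D" unfolding pullback_def by blast
qed

lemma linear_sum_preimage:
  assumes "linear_code M D"
  shows "linear_code N (sum_preimage D)"
proof -
  have add: "block_sums (v + w) = block_sums v + block_sums w" for v w
    unfolding fun_eq_iff block_sums_def plus_fun_apply sum.distrib by blast
  have zero: "block_sums 0 = 0"
    by (simp add: fun_eq_iff block_sums_def)
  show ?thesis
    using assms by (auto simp: linear_code_iff sum_preimage_def words_def add zero)
qed

lemma permute_pullback_iff:
  assumes D: "D \<subseteq> words M" and p: "p permutes {1..N}" and q: "q permutes {1..M}" and "covers p q"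
  shows "p \<in> word_perms N (pullback D) \<longleftrightarrow> q \<in> word_perms M D"
proof -
  have act: "permute_word p v i = permute_word q y (block i)"
    if "\<forall>i\<in>{1..N}. v i = y (block i)" "i \<in> {1..N}" for v y i
  proof -
    have "inv' p i \<in> {1..N}" using that(2) by (simp only: permutes_in_image[OF permutes_inv[OF p]])
    then show ?thesis
      using that covers_inv[OF p q \<open>covers p q\<close> that(2)] by (simp add: permute_word_def)
  qed
  show ?thesis
  proof
    assume q': "q \<in> word_perms M D"
    have "permute_word p v \<in> pullback D" if v: "v \<in> pullback D" for v
    proof -
      obtain y where "y \<in> D" "\<forall>i\<in>{1..N}. v i = y (block i)"
        using v by (auto simp: pullback_def)
      then show ?thesis
        using act q' v permute_word_words[OF p] unfolding pullback_def word_perms_def by blast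
    qed
    then show "p \<in> word_perms N (pullback D)" using p by (auto simp: word_perms_def)
  next
    assume p': "p \<in> word_perms N (pullback D)"
    have "permute_word q y \<in> D" if y: "y \<in> D" for y
    proof -
      define v where "v i = (if i \<in> {1..N} then y (block i) else 0)" for i
      have "v \<in> pullback D" using y by (auto simp: pullback_def words_def v_def)
      then have "permute_word p v \<in> pullback D" using p' by (auto simp: word_perms_def)
      then obtain z where z: "z \<in> D" "\<forall>i\<in>{1..N}. permute_word p v i = z (block i)"
        by (auto simp: pullback_def)
      have "permute_word q y b = z b" for b
      proof (cases "b \<in> {1..M}")
        case True
        then obtain i where "i \<in> {1..N}" "b = block i" using block_image by blast
        then show ?thesis using act[of v y i] z by (simp add: v_def)
      next
        case False
        then have "inv' q b \<notin> {1..M}"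
          by (simp only: permutes_in_image[OF permutes_inv[OF q]] not_False_eq_True)
        moreover have "y \<in> words M" "z \<in> words M" using D y z(1) by auto
        ultimately have "y (inv' q b) = 0" "z b = 0"
          using False unfolding words_def by blast+
        then show ?thesis by (simp add: permute_word_def)
      qed
      then have "permute_word q y = z" by blast
      with z show ?thesis by simp
    qed
    then show "q \<in> word_perms M D" using q by (auto simp: word_perms_def)
  qed
qed

lemma block_sums_permute:
  assumes p: "p permutes {1..N}" and q: "q permutes {1..M}" and "covers p q"
  shows "block_sums (permute_word p v) = permute_word q (block_sums v)"
proof
  fix b
  have "block_sums (permute_word p v) b = (\<Sum>i | i \<in> {1..N} \<and> block i = b. v (inv' p i))"
    by (simp add: block_sums_def permute_word_def)
  also have "\<dots> = (\<Sum>j | j \<in> {1..N} \<and> block j = inv' q b. v j)"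
  proof (rule sum.reindex_bij_witness[of _ p "inv' p"])
    fix i assume i: "i \<in> {i. i \<in> {1..N} \<and> block i = b}"
    then have "inv' p i \<in> {1..N}" using permutes_in_image[OF permutes_inv[OF p]] by blast
    then show "inv' p i \<in> {j. j \<in> {1..N} \<and> block j = inv' q b}"
      using i covers_inv[OF assms] by blast
  next
    fix j assume j: "j \<in> {j. j \<in> {1..N} \<and> block j = inv' q b}"
    then have "block (p j) = q (inv' q b)" using \<open>covers p q\<close> by (auto simp: covers_def)
    then show "p j \<in> {i. i \<in> {1..N} \<and> block i = b}"
      using j permutes_in_image[OF p] permutes_inverses[OF q] by auto
  qed (use permutes_inverses[OF p] in auto)
  also have "\<dots> = permute_word q (block_sums v) b"
    by (simp add: block_sums_def permute_word_def)
  finally show "block_sums (permute_word p v) b = permute_word q (block_sums v) b" .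
qed

text \<open>
  Put the prescribed value of each block on one representative coordinate.
\<close>

lemma block_sums_surj:
  assumes "y \<in> words M"
  obtains v where "v \<in> words N" "block_sums v = y"
proof -
  define s where "s = inv_into {1..N} block"
  have s: "s b \<in> {1..N}" "block (s b) = b" if "b \<in> {1..M}" for b
    using that inv_into_into[of b block "{1..N}"] f_inv_into_f[of b block "{1..N}"]
    by (simp_all only: s_def block_image)
  define v where "v i = (if i \<in> {1..N} \<and> s (block i) = i then y (block i) else 0)" for i
  have "block_sums v b = y b" for b
  proof (cases "b \<in> {1..M}")
    case True
    have "block_sums v b = (\<Sum>i | i \<in> {1..N} \<and> block i = b. if i = s b then y b else 0)"
      unfolding block_sums_def by (intro sum.cong) (auto simp: v_def)
    also have "\<dots> = y b" using s[OF True] by (simp add: sum.delta)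
    finally show ?thesis .
  next
    case False
    then have "{i. i \<in> {1..N} \<and> block i = b} = {}" using block_range by blast
    then have "block_sums v b = 0" unfolding block_sums_def by (simp only: sum.empty)
    then show ?thesis using False assms by (auto simp: words_def)
  qed
  then have "block_sums v = y" by blast
  moreover have "v \<in> words N" by (auto simp: v_def words_def)
  ultimately show thesis using that by blast
qed

lemma permute_sum_preimage_iff:
  assumes D: "D \<subseteq> words M" and p: "p permutes {1..N}" and q: "q permutes {1..M}" and "covers p q"
  shows "p \<in> word_perms N (sum_preimage D) \<longleftrightarrow> q \<in> word_perms M D"
proof
  assume "q \<in> word_perms M D"
  then show "p \<in> word_perms N (sum_preimage D)"
    using p permute_word_words[OF p] block_sums_permute[OF p q \<open>covers p q\<close>]
    by (auto simp: word_perms_def sum_preimage_def)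
next
  assume p': "p \<in> word_perms N (sum_preimage D)"
  have "permute_word q y \<in> D" if y: "y \<in> D" for y
  proof -
    obtain v where v: "v \<in> words N" "block_sums v = y"
      using block_sums_surj[OF subsetD[OF D y]] .
    then have "permute_word p v \<in> sum_preimage D"
      using p' y by (auto simp: word_perms_def sum_preimage_def)
    then show ?thesis
      using v block_sums_permute[OF p q \<open>covers p q\<close>] by (auto simp: sum_preimage_def)
  qed
  then show "q \<in> word_perms M D" using q by (auto simp: word_perms_def)
qed

text \<open>
  The group of automorphisms is closed under inverses, so the backward implication for \<open>p\<close> is the
  forward one for its inverse.
\<close>

lemma preserves_blocks_if_inv:
  assumes p: "p permutes {1..N}"
    and fwd: "\<And>r i k. r \<in> {p, inv' p} \<Longrightarrow> i \<in> {1..N} \<Longrightarrow> k \<in> {1..N} \<Longrightarrow>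
        block i = block k \<Longrightarrow> block (r i) = block (r k)"
  shows "preserves_blocks p"
  unfolding preserves_blocks_def
proof (intro ballI iffI)
  fix i k assume i: "i \<in> {1..N}" "k \<in> {1..N}"
  then have pi: "p i \<in> {1..N}" "p k \<in> {1..N}" using permutes_in_image[OF p] by blast+
  show "block i = block k" if "block (p i) = block (p k)"
    using fwd[OF _ pi that, of "inv' p"] permutes_inverses[OF p] by simp
  show "block (p i) = block (p k)" if "block i = block k"
    using fwd[OF _ i that] by blast
qed

text \<open>
  That all words agree at \<open>i\<close> and \<open>k\<close> is a condition invariant under automorphisms, and over a
  separating code it says that \<open>i\<close> and \<open>k\<close> lie in one block.
\<close>

lemma pullback_Aut_preserves_blocks:
  assumes D: "linear_code M D" "separating M D" and p: "p \<in> word_perms N (pullback D)"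
  shows "preserves_blocks p"
proof (rule preserves_blocks_if_inv)
  show "p permutes {1..N}" using p by (simp add: word_perms_def)
next
  fix r i k
  assume "r \<in> {p, inv' p}" and i: "i \<in> {1..N}" "k \<in> {1..N}" and eq: "block i = block k"
  then have r: "r \<in> word_perms N (pullback D)"
    using p word_perms_inv[OF linear_pullback[OF D(1)]] by blast
  then have perm: "r permutes {1..N}" by (simp add: word_perms_def)
  have ri: "r i \<in> {1..N}" "r k \<in> {1..N}" using i permutes_in_image[OF perm] by blast+
  have "y (block (r i)) = y (block (r k))" if "y \<in> D" for y
  proof -
    define v where "v i = (if i \<in> {1..N} then y (block i) else 0)" for i
    have "v \<in> pullback D" using that by (auto simp: pullback_def words_def v_def)
    then have "permute_word (inv' r) v \<in> pullback D"
      using word_perms_inv[OF linear_pullback[OF D(1)] r] by (auto simp: word_perms_def)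
    then have "permute_word (inv' r) v i = permute_word (inv' r) v k"
      using i eq by (auto simp: pullback_def)
    then have "v (r i) = v (r k)"
      using inv_inv_eq[OF permutes_bij[OF perm]] by (simp add: permute_word_def)
    then show ?thesis using ri by (simp add: v_def)
  qed
  then show "block (r i) = block (r k)"
    using D(2) block_range[OF ri(1)] block_range[OF ri(2)] unfolding separating_def by blast
qed

lemma block_sums_pair_word:
  assumes "i \<in> {1..N}" "k \<in> {1..N}"
  shows "block_sums (pair_word i k) = pair_word (block i) (block k)"
proof
  fix b
  have "(\<Sum>j | j \<in> {1..N} \<and> block j = b. of_bool (j = i) :: bit) = of_bool (b = block i)"
    if "i \<in> {1..N}" for i
    using that unfolding of_bool_def by (subst sum.delta) auto
  then show "block_sums (pair_word i k) b = pair_word (block i) (block k) b"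
    using assms unfolding block_sums_def pair_word_def sum.distrib by (simp only:)
qed

lemma pair_word_in_words: "i \<in> {1..N} \<Longrightarrow> k \<in> {1..N} \<Longrightarrow> pair_word i k \<in> words N"
  by (auto simp: words_def pair_word_def)

lemma pair_word_self: "pair_word i i = 0"
  by (simp add: pair_word_def fun_eq_iff)

lemma pair_word_in_sum_preimage_iff:
  assumes D: "linear_code M D" "pair_free M D" and i: "i \<in> {1..N}" "k \<in> {1..N}"
  shows "pair_word i k \<in> sum_preimage D \<longleftrightarrow> block i = block k"
proof -
  have "pair_word i k \<in> sum_preimage D \<longleftrightarrow> pair_word (block i) (block k) \<in> D"
    using i by (simp add: sum_preimage_def pair_word_in_words block_sums_pair_word)
  also have "\<dots> \<longleftrightarrow> block i = block k"
    using D block_range[OF i(1)] block_range[OF i(2)] pair_word_self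
    unfolding pair_free_def linear_code_iff by metis
  finally show ?thesis .
qed

text \<open>
  Automorphisms move the words of weight 2 among each other, and over a pair-free code their supports
  are the pairs of coordinates in one block.
\<close>

lemma sum_preimage_Aut_preserves_blocks:
  assumes D: "linear_code M D" "pair_free M D" and p: "p \<in> word_perms N (sum_preimage D)"
  shows "preserves_blocks p"
proof (rule preserves_blocks_if_inv)
  show "p permutes {1..N}" using p by (simp add: word_perms_def)
next
  fix r i k
  assume "r \<in> {p, inv' p}" and i: "i \<in> {1..N}" "k \<in> {1..N}" and eq: "block i = block k"
  then have r: "r \<in> word_perms N (sum_preimage D)"
    using p word_perms_inv[OF linear_sum_preimage[OF D(1)]] by blast
  then have perm: "r permutes {1..N}" by (simp add: word_perms_def)
  have ri: "r i \<in> {1..N}" "r k \<in> {1..N}" using i permutes_in_image[OF perm] by blast+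
  have "pair_word i k \<in> sum_preimage D"
    using pair_word_in_sum_preimage_iff[OF D i] eq by simp
  then have "pair_word (r i) (r k) \<in> sum_preimage D"
    using r permute_pair_word[OF perm] by (force simp: word_perms_def)
  then show "block (r i) = block (r k)"
    using pair_word_in_sum_preimage_iff[OF D ri] by simp
qed

theorem word_perms_pullback:
  assumes D: "linear_code M D" "separating M D"
  shows "word_perms N (pullback D) = lift (word_perms M D)"
proof -
  have DM: "D \<subseteq> words M" using D(1) by (simp add: linear_code_def)
  show ?thesis
  proof (intro equalityI subsetI)
    fix p assume p: "p \<in> word_perms N (pullback D)"
    then have perm: "p permutes {1..N}" by (simp add: word_perms_def)
    obtain q where q: "q permutes {1..M}" "covers p q"
      using preserves_blocks_imp_covers[OF perm pullback_Aut_preserves_blocks[OF D p]] .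
    then show "p \<in> lift (word_perms M D)"
      using p perm permute_pullback_iff[OF DM perm q] unfolding lift_def by blast
  next
    fix p assume "p \<in> lift (word_perms M D)"
    then obtain q where q: "p permutes {1..N}" "q \<in> word_perms M D" "covers p q"
      by (auto simp: lift_def)
    then have "q permutes {1..M}" by (simp add: word_perms_def)
    then show "p \<in> word_perms N (pullback D)"
      using q permute_pullback_iff[OF DM] by blast
  qed
qed

theorem word_perms_sum_preimage:
  assumes D: "linear_code M D" "pair_free M D"
  shows "word_perms N (sum_preimage D) = lift (word_perms M D)"
proof -
  have DM: "D \<subseteq> words M" using D(1) by (simp add: linear_code_def)
  show ?thesis
  proof (intro equalityI subsetI)
    fix p assume p: "p \<in> word_perms N (sum_preimage D)"
    then have perm: "p permutes {1..N}" by (simp add: word_perms_def)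
    obtain q where q: "q permutes {1..M}" "covers p q"
      using preserves_blocks_imp_covers[OF perm sum_preimage_Aut_preserves_blocks[OF D p]] .
    then show "p \<in> lift (word_perms M D)"
      using p perm permute_sum_preimage_iff[OF DM perm q] unfolding lift_def by blast
  next
    fix p assume "p \<in> lift (word_perms M D)"
    then obtain q where q: "p permutes {1..N}" "q \<in> word_perms M D" "covers p q"
      by (auto simp: lift_def)
    then have "q permutes {1..M}" by (simp add: word_perms_def)
    then show "p \<in> word_perms N (sum_preimage D)"
      using q permute_sum_preimage_iff[OF DM] by blast
  qed
qed

text \<open>
  A word of weight 2 cannot be constant on a block that meets its support, as the block has a third
  coordinate.
\<close>

lemma pair_free_pullback: "pair_free N (pullback D)"
  unfolding pair_free_def
proof (intro ballI impI notI)
  fix i k assume i: "i \<in> {1..N}" "k \<in> {1..N}" "i \<noteq> k" and mem: "pair_word i k \<in> pullback D"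
  obtain l where l: "l \<in> {1..N}" "block l = block i" "l \<noteq> i" "l \<noteq> k"
    using third_in_block[OF i(1)] .
  then have "pair_word i k l = pair_word i k i"
    using mem i by (auto simp: pullback_def)
  then show False using i l by (simp add: pair_word_def)
qed

text \<open>
  The word supported on \<open>i\<close> and a coordinate \<open>l \<noteq> k\<close> of the same block has block sums 0.
\<close>

lemma separating_sum_preimage:
  assumes "linear_code M D"
  shows "separating N (sum_preimage D)"
  unfolding separating_def
proof (intro ballI impI)
  fix i k assume i: "i \<in> {1..N}" "k \<in> {1..N}" "i \<noteq> k"
  obtain l where l: "l \<in> {1..N}" "block l = block i" "l \<noteq> i" "l \<noteq> k"
    using third_in_block[OF i(1)] .
  have "pair_word i l \<in> sum_preimage D"
    using i l assms
    by (simp add: sum_preimage_def pair_word_in_words block_sums_pair_word pair_word_self linear_code_iff)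
  moreover have "pair_word i l i \<noteq> pair_word i l k"
    using i l by (simp add: pair_word_def)
  ultimately show "\<exists>v\<in>sum_preimage D. v i \<noteq> v k" by blast
qed

end

section \<open>The chain of congruences\<close>

lemma permutes_if_inj_on:
  assumes "finite A" "f ` A \<subseteq> A" "inj_on f A" "\<And>x. x \<notin> A \<Longrightarrow> f x = x"
  shows "f permutes A"
  using assms by (intro bij_imp_permutes) (auto simp: bij_betw_def endo_inj_surj)

lemma Suc_mod_eq_iff: "Suc x mod d = Suc y mod d \<longleftrightarrow> x mod d = y mod d" for x y d :: nat
  by (auto simp: mod_Suc)

lemma prod_list_pos: "0 \<notin> set ns \<Longrightarrow> 0 < prod_list ns" for ns :: "nat list"
  by (induction ns) auto

fun moduli :: "nat list \<Rightarrow> nat set" where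
  "moduli [] = {}"
| "moduli (n # ns) = insert (prod_list ns) (moduli ns)"

lemma moduli_dvd: "d \<in> moduli ns \<Longrightarrow> d dvd prod_list ns"
  by (induction ns) auto

lemma moduli_snoc: "moduli (ns @ [n]) = insert 1 ((\<lambda>d. d * n) ` moduli ns)"
  by (induction ns) auto

lemma one_in_moduli: "ns \<noteq> [] \<Longrightarrow> 1 \<in> moduli ns"
  by (induction ns rule: rev_induct) (auto simp: moduli_snoc)

text \<open>
  The points of \<open>{1..n\<^sub>1\<cdots>n\<^sub>r}\<close> are grouped into nested blocks by the congruences modulo
  \<open>n\<^sub>j\<cdots>n\<^sub>r\<close>, \<open>j = 2, \<dots>, r\<close>, and modulo 1. Residue classes are chosen as blocks, rather than
  intervals, because the shift \<open>i \<mapsto> i + 1\<close> respects every such congruence. Demanding an equivalence,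
  and not just that congruent points stay congruent, makes the induced maps on blocks injective by
  definition.
\<close>

definition tower :: "nat list \<Rightarrow> (nat \<Rightarrow> nat) set" where
  "tower ns = {p. p permutes {1..prod_list ns} \<and>
     (\<forall>d\<in>moduli ns. \<forall>i\<in>{1..prod_list ns}. \<forall>k\<in>{1..prod_list ns}.
        p i mod d = p k mod d \<longleftrightarrow> i mod d = k mod d)}"

lemma tower_permutes: "p \<in> tower ns \<Longrightarrow> p permutes {1..prod_list ns}"
  by (simp add: tower_def)

lemma tower_mod:
  "p \<in> tower ns \<Longrightarrow> d \<in> moduli ns \<Longrightarrow> i \<in> {1..prod_list ns} \<Longrightarrow> k \<in> {1..prod_list ns} \<Longrightarrow>
   p i mod d = p k mod d \<longleftrightarrow> i mod d = k mod d"
  by (simp add: tower_def)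

text \<open>
  The representative of the residue class of \<open>i\<close> that lies in \<open>{1..M}\<close> instead of \<open>{0..<M}\<close>:
  it is the coordinate of a code of length \<open>M\<close> over which the coordinate \<open>i\<close> lies.
\<close>

definition residue :: "nat \<Rightarrow> nat \<Rightarrow> nat" where
  "residue M i = (i - 1) mod M + 1"

lemma residue_range: "0 < M \<Longrightarrow> residue M i \<in> {1..M}"
  by (simp add: residue_def Suc_leI)

lemma residue_mod:
  assumes "d dvd M" "1 \<le> i"
  shows "residue M i mod d = i mod d"
proof -
  obtain x where "i = Suc x" using assms(2) by (cases i) auto
  moreover have "Suc (x mod M) mod d = Suc x mod d"
    using assms(1) by (simp add: Suc_mod_eq_iff mod_mod_cancel)
  ultimately show ?thesis by (simp add: residue_def)
qed

lemma residue_eq_iff: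
  assumes "1 \<le> i" "1 \<le> k"
  shows "residue M i = residue M k \<longleftrightarrow> i mod M = k mod M"
  using assms Suc_mod_eq_iff[of "i - 1" M "k - 1"] by (simp add: residue_def)

text \<open>
  A residue class modulo \<open>M\<close> has \<open>n\<close> elements in \<open>{1..n * M}\<close>; this is where \<open>n \<ge> 3\<close> enters.
\<close>

lemma residue_block_projection:
  assumes "3 \<le> n" "0 < M"
  shows "block_projection (n * M) M (residue M)"
proof
  fix b assume b: "b \<in> {1..M}"
  have "3 * M \<le> n * M" using assms(1) by (rule mult_le_mono1)
  moreover have "b \<le> M" using b by simp
  ultimately have "b \<le> n * M" "b + M \<le> n * M" "b + 2 * M \<le> n * M" by linarith+
  moreover have "residue M (b + j * M) = b" for j
  proof -
    obtain c where "b = Suc c" "c < M" using b by (cases b) auto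
    then show ?thesis by (simp add: residue_def)
  qed
  note this[of 0] this[of 1] this[of 2]
  ultimately have "{b, b + M, b + 2 * M} \<subseteq> {i \<in> {1..n * M}. residue M i = b}"
    using b by auto
  then have "card {b, b + M, b + 2 * M} \<le> card {i \<in> {1..n * M}. residue M i = b}"
    by (rule card_mono[rotated]) simp
  then show "3 \<le> card {i \<in> {1..n * M}. residue M i = b}" using assms(2) by simp
qed (use assms residue_range in blast)

text \<open>
  The moduli of \<open>n # ns\<close> are \<open>M\<close> and those of \<open>ns\<close>. Respecting the congruence modulo \<open>M\<close> means
  inducing a permutation of the blocks. The other moduli divide \<open>M\<close>, so that a point and its block
  have the same residue, and their congruences can be tested on the induced permutation.
\<close>

lemma lift_tower:
  assumes "3 \<le> n" "0 < prod_list ns"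
  shows "block_projection.lift (n * prod_list ns) (residue (prod_list ns)) (tower ns) = tower (n # ns)"
proof -
  define M where "M = prod_list ns"
  interpret block_projection "n * M" M "residue M"
    using residue_block_projection assms by (simp add: M_def)
  have perm_iff: "(p permutes {1..prod_list (n # ns)}) = (p permutes {1..n * M})" for p
    by (simp add: M_def)
  show ?thesis unfolding M_def[symmetric]
  proof (intro equalityI subsetI)
    fix p assume "p \<in> lift (tower ns)"
    then obtain q where p: "p permutes {1..n * M}" and q: "q \<in> tower ns" "covers p q"
      by (auto simp: lift_def)
    have qM: "q permutes {1..M}" using tower_permutes[OF q(1)] by (simp add: M_def)
    have "p i mod d = p k mod d \<longleftrightarrow> i mod d = k mod d"
      if d: "d \<in> moduli (n # ns)" and i: "i \<in> {1..n * M}" "k \<in> {1..n * M}" for d i k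
    proof -
      have ge: "1 \<le> i" "1 \<le> k" "1 \<le> p i" "1 \<le> p k"
        using i permutes_in_image[OF p, of i] permutes_in_image[OF p, of k] by auto
      consider "d = M" | "d \<in> moduli ns" using d by (auto simp: M_def)
      then show ?thesis
      proof cases
        case 1
        then show ?thesis
          using covers_imp_preserves_blocks[OF qM q(2)] i
            residue_eq_iff[OF ge(1,2), of M] residue_eq_iff[OF ge(3,4), of M]
          unfolding preserves_blocks_def by blast
      next
        case 2
        then have dM: "d dvd M" using moduli_dvd by (simp add: M_def)
        have "p i mod d = p k mod d \<longleftrightarrow> residue M (p i) mod d = residue M (p k) mod d"
          using ge dM by (simp add: residue_mod)
        also have "\<dots> \<longleftrightarrow> q (residue M i) mod d = q (residue M k) mod d"
          using q(2) i unfolding covers_def by simp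
        also have "\<dots> \<longleftrightarrow> residue M i mod d = residue M k mod d"
          using tower_mod[OF q(1) 2] block_range[OF i(1)] block_range[OF i(2)] by (simp add: M_def)
        also have "\<dots> \<longleftrightarrow> i mod d = k mod d"
          using ge dM by (simp add: residue_mod)
        finally show ?thesis .
      qed
    qed
    then show "p \<in> tower (n # ns)"
      using p unfolding tower_def mem_Collect_eq perm_iff by (auto simp: M_def)
  next
    fix p assume p': "p \<in> tower (n # ns)"
    then have p: "p permutes {1..n * M}" using perm_iff tower_permutes by blast
    have pm: "p i mod d = p k mod d \<longleftrightarrow> i mod d = k mod d"
      if "d \<in> moduli (n # ns)" "i \<in> {1..n * M}" "k \<in> {1..n * M}" for d i k
      using tower_mod[OF p' that(1)] that by (simp add: M_def)
    have pi: "1 \<le> p i" if "i \<in> {1..n * M}" for i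
      using that permutes_in_image[OF p, of i] by auto
    have "preserves_blocks p"
      unfolding preserves_blocks_def
    proof (intro ballI)
      fix i k assume i: "i \<in> {1..n * M}" "k \<in> {1..n * M}"
      then have "p i mod M = p k mod M \<longleftrightarrow> i mod M = k mod M"
        by (intro pm) (simp add: M_def)
      then show "residue M (p i) = residue M (p k) \<longleftrightarrow> residue M i = residue M k"
        using i pi by (simp add: residue_eq_iff)
    qed
    then obtain q where q: "q permutes {1..M}" "covers p q"
      using preserves_blocks_imp_covers[OF p] by blast
    have "q b mod d = q c mod d \<longleftrightarrow> b mod d = c mod d"
      if d: "d \<in> moduli ns" and b: "b \<in> {1..M}" "c \<in> {1..M}" for d b c
    proof -
      have dM: "d dvd M" using moduli_dvd d by (simp add: M_def)
      obtain i k where i: "i \<in> {1..n * M}" "b = residue M i" and k: "k \<in> {1..n * M}" "c = residue M k"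
        using b block_image by blast
      have "q b mod d = q c mod d \<longleftrightarrow> residue M (p i) mod d = residue M (p k) mod d"
        using q(2) i k unfolding covers_def by simp
      also have "\<dots> \<longleftrightarrow> p i mod d = p k mod d"
        using pi[OF i(1)] pi[OF k(1)] dM by (simp add: residue_mod)
      also have "\<dots> \<longleftrightarrow> i mod d = k mod d"
        using pm[OF _ i(1) k(1)] d by simp
      also have "\<dots> \<longleftrightarrow> b mod d = c mod d"
        using i k dM by (simp add: residue_mod)
      finally show ?thesis .
    qed
    then have "q \<in> tower ns" using q(1) by (auto simp: tower_def M_def)
    then show "p \<in> lift (tower ns)" using p q(2) by (auto simp: lift_def)
  qed
qed

section \<open>Codes whose automorphism group is the tower\<close>

text \<open>
  Pullback needs a separating code but yields one in which the coordinates of a block agree, so it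
  cannot be iterated on its own; dually, the preimage under block sums needs a pair-free code but
  contains pairs. Each construction, however, yields what the other one needs. The induction
  therefore carries two codes and applies each construction to the code that the other one
  produced.
\<close>

lemma code_pair_exists:
  assumes "\<forall>n\<in>set ns. 3 \<le> n"
  shows "\<exists>C D. linear_code (prod_list ns) C \<and> separating (prod_list ns) C \<and>
      word_perms (prod_list ns) C = tower ns \<and>
      linear_code (prod_list ns) D \<and> pair_free (prod_list ns) D \<and>
      word_perms (prod_list ns) D = tower ns"
  using assms
proof (induction ns)
  case Nil
  have "linear_code 1 (words 1)"
    by (auto simp: linear_code_iff words_def)
  moreover have "word_perms 1 (words 1) = tower []"
    using permute_word_words[of _ 1] by (auto simp: word_perms_def tower_def)
  ultimately show ?case
    by (intro exI[of _ "words 1"]) (simp add: separating_def pair_free_def)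
next
  case (Cons n ns)
  then obtain C D where C: "linear_code (prod_list ns) C" "separating (prod_list ns) C"
      "word_perms (prod_list ns) C = tower ns"
    and D: "linear_code (prod_list ns) D" "pair_free (prod_list ns) D"
      "word_perms (prod_list ns) D = tower ns"
    by auto
  have pos: "0 < prod_list ns" using Cons.prems by (intro prod_list_pos) auto
  interpret block_projection "n * prod_list ns" "prod_list ns" "residue (prod_list ns)"
    using residue_block_projection[OF _ pos] Cons.prems by simp
  have "lift (tower ns) = tower (n # ns)" using lift_tower[OF _ pos] Cons.prems by simp
  then show ?case
    using linear_sum_preimage[OF D(1)] separating_sum_preimage[OF D(1)]
      word_perms_sum_preimage[OF D(1,2)] linear_pullback[OF C(1)]
      word_perms_pullback[OF C(1,2)] pair_free_pullback[of C] C(3) D(3)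
    by (intro exI[of _ "sum_preimage D"] exI[of _ "pullback C"]) simp
qed

lemma cycle_of_upt:
  assumes "i \<in> {1..N}"
  shows "cycle_of_list [1..<Suc N] i = (if i < N then Suc i else 1)"
proof -
  let ?cs = "[1..<Suc N]"
  have "map (cycle_of_list ?cs) ?cs ! (i - 1) = rotate 1 ?cs ! (i - 1)"
    using cyclic_rotation[of ?cs 1] by simp
  also have "\<dots> = ?cs ! ((1 + (i - 1)) mod N)"
    using assms by (subst nth_rotate) auto
  also have "\<dots> = (if i < N then Suc i else 1)"
    using assms by (auto simp: nth_append nth_upt simp del: upt_Suc)
  also have "map (cycle_of_list ?cs) ?cs ! (i - 1) = cycle_of_list ?cs i"
    using assms by (subst nth_map) (auto simp: nth_upt simp del: upt_Suc)
  finally show ?thesis .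
qed

text \<open>
  The cycle acts as \<open>i \<mapsto> i + 1\<close> modulo \<open>N\<close>, hence modulo each of the moduli, which all divide \<open>N\<close>.
\<close>

lemma cycle_in_tower: "cycle_of_list [1..<Suc (prod_list ns)] \<in> tower ns"
proof -
  let ?N = "prod_list ns"
  define c where "c = cycle_of_list [1..<Suc ?N]"
  have c: "c i = (if i < ?N then Suc i else 1)" if "i \<in> {1..?N}" for i
    using cycle_of_upt[OF that] by (simp only: c_def)
  have shift: "c i mod d = Suc i mod d" if "d \<in> moduli ns" "i \<in> {1..?N}" for d i
  proof (cases "i < ?N")
    case False
    have "Suc ?N mod d = 1 mod d"
      using Suc_mod_eq_iff[of ?N d 0] moduli_dvd[OF that(1)] by simp
    then show ?thesis using False that(2) c[OF that(2)] by auto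
  qed (use that c in simp)
  have "c permutes {1..?N}"
    using cycle_permutes[of "[1..<Suc ?N]"]
    by (simp add: c_def atLeastLessThanSuc_atLeastAtMost del: upt_Suc)
  then have "c \<in> tower ns" by (simp add: tower_def shift Suc_mod_eq_iff)
  then show ?thesis by (simp only: c_def)
qed

section \<open>The tower as an iterated wreath product\<close>

text \<open>
  The points of \<open>{1..m * n}\<close> form an \<open>m \<times> n\<close> grid, numbered row by row from 1; the column of a point is
  its \<^const>\<open>residue\<close> modulo \<open>n\<close>. The columns are the coarsest blocks, on which the top group
  of the wreath product acts.
\<close>

definition cell :: "nat \<Rightarrow> nat \<Rightarrow> nat \<Rightarrow> nat" where
  "cell n a b = (a - 1) * n + b"

definition row :: "nat \<Rightarrow> nat \<Rightarrow> nat" where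
  "row n i = (i - 1) div n + 1"

lemma cell_range: "a \<in> {1..m} \<Longrightarrow> b \<in> {1..n} \<Longrightarrow> cell n a b \<in> {1..m * n}"
proof -
  assume a: "a \<in> {1..m}" "b \<in> {1..n}"
  then have "(a - 1) * n + n \<le> m * n"
    by (metis Suc_diff_1 Suc_le_eq add.commute atLeastAtMost_iff mult_Suc mult_le_mono1 One_nat_def)
  then show ?thesis using a by (auto simp: cell_def)
qed

lemma row_range:
  assumes "i \<in> {1..m * n}"
  shows "row n i \<in> {1..m}"
proof -
  have "i - 1 < m * n" using assms by auto
  then have "(i - 1) div n < m" by (rule less_mult_imp_div_less)
  then show ?thesis by (simp add: row_def)
qed

lemma cell_Suc_minus_1: "cell n a (Suc c) - 1 = c + (a - 1) * n"
  by (simp add: cell_def)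

lemma row_cell:
  assumes "1 \<le> a" "b \<in> {1..n}"
  shows "row n (cell n a b) = a"
proof -
  obtain c where "b = Suc c" "c < n" using assms(2) by (cases b) auto
  then show ?thesis using assms(1) unfolding row_def by (simp only: cell_Suc_minus_1) simp
qed

lemma residue_cell:
  assumes "b \<in> {1..n}"
  shows "residue n (cell n a b) = b"
proof -
  obtain c where "b = Suc c" "c < n" using assms by (cases b) auto
  then show ?thesis unfolding residue_def by (simp only: cell_Suc_minus_1) simp
qed

lemma cell_row_residue: "1 \<le> i \<Longrightarrow> cell n (row n i) (residue n i) = i"
  by (simp add: cell_def row_def residue_def)

lemma cell_cases:
  assumes "i \<in> {1..m * n}"
  obtains a b where "a \<in> {1..m}" "b \<in> {1..n}" "i = cell n a b"
proof -
  have "0 < n" using assms by (cases n) auto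
  then show thesis
    using that[OF row_range[OF assms] residue_range[of n i]] cell_row_residue[of i n] assms by simp
qed

lemma cell_eq_iff:
  assumes "1 \<le> a" "1 \<le> a'" "b \<in> {1..n}" "b' \<in> {1..n}"
  shows "cell n a b = cell n a' b' \<longleftrightarrow> a = a' \<and> b = b'"
  using assms row_cell residue_cell by metis

text \<open>
  The moduli of \<open>ns @ [n]\<close>, apart from 1, are the multiples \<open>d * n\<close> with \<open>d\<close> a modulus of \<open>ns\<close>: points
  are congruent if they share their column and their rows are congruent modulo \<open>d\<close>. The case
  \<open>d = 0\<close> is the injectivity of the numbering.
\<close>

lemma cell_mod_eq_iff:
  assumes a: "1 \<le> a" "1 \<le> a'" and b: "b \<in> {1..n}" "b' \<in> {1..n}"
  shows "cell n a b mod (d * n) = cell n a' b' mod (d * n) \<longleftrightarrow> b = b' \<and> a mod d = a' mod d"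
proof -
  have mod: "(cell n a b - 1) mod (d * n) = (b - 1) + n * ((a - 1) mod d)"
    if b: "b \<in> {1..n}" for a b
  proof -
    obtain c where c: "b = Suc c" "c < n" using b by (cases b) auto
    then have "(c + (a - 1) * n) mod (n * d) = c + n * ((a - 1) mod d)"
      using mod_mult2_eq[of "c + (a - 1) * n" n d] by simp
    then show ?thesis using c by (simp only: cell_Suc_minus_1 mult.commute[of d n] diff_Suc_1)
  qed
  have "cell n a b mod (d * n) = cell n a' b' mod (d * n) \<longleftrightarrow>
      (cell n a b - 1) mod (d * n) = (cell n a' b' - 1) mod (d * n)"
    using Suc_mod_eq_iff[of "cell n a b - 1" "d * n" "cell n a' b' - 1"] b by (simp add: cell_def)
  also have "\<dots> \<longleftrightarrow> (b - 1) + n * ((a - 1) mod d) = (b' - 1) + n * ((a' - 1) mod d)"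
    using b by (simp only: mod)
  also have "\<dots> \<longleftrightarrow> b - 1 = b' - 1 \<and> (a - 1) mod d = (a' - 1) mod d"
  proof
    assume eq: "(b - 1) + n * ((a - 1) mod d) = (b' - 1) + n * ((a' - 1) mod d)"
    have "(b - 1) mod n = b - 1" "(b' - 1) mod n = b' - 1" using b by auto
    then have "((b - 1) + n * ((a - 1) mod d)) mod n = b - 1"
      "((b' - 1) + n * ((a' - 1) mod d)) mod n = b' - 1"
      by (simp_all only: mod_mult_self2)
    then have "b - 1 = b' - 1" using eq by metis
    then show "b - 1 = b' - 1 \<and> (a - 1) mod d = (a' - 1) mod d" using eq b by auto
  qed simp
  also have "\<dots> \<longleftrightarrow> b = b' \<and> a mod d = a' mod d"
    using Suc_mod_eq_iff[of "a - 1" d "a' - 1"] a b by auto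
  finally show ?thesis .
qed

text \<open>
  The imprimitive action: \<open>f\<close> permutes the points of column \<open>b\<close> by \<open>f b\<close> and then \<open>p\<close> permutes
  the columns. With this order composition matches the multiplication of \<^const>\<open>wreath_sym\<close>.
\<close>

definition wreath_action ::
    "nat \<Rightarrow> nat \<Rightarrow> (nat \<Rightarrow> nat) \<times> (nat \<Rightarrow> nat \<Rightarrow> nat) \<Rightarrow> nat \<Rightarrow> nat" where
  "wreath_action m n = (\<lambda>(p, f) i. if i \<in> {1..m * n}
     then cell n (f (residue n i) (row n i)) (p (residue n i)) else i)"

lemma wreath_action_cell:
  assumes "a \<in> {1..m}" "b \<in> {1..n}"
  shows "wreath_action m n (p, f) (cell n a b) = cell n (f b a) (p b)"
  using assms cell_range[OF assms] by (simp add: wreath_action_def row_cell residue_cell)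

lemma wreath_action_outside: "i \<notin> {1..m * n} \<Longrightarrow> wreath_action m n x i = i"
  by (auto simp: wreath_action_def split: prod.splits)

abbreviation tower_group :: "nat list \<Rightarrow> (nat \<Rightarrow> nat) monoid" where
  "tower_group ns \<equiv> (sym_group (prod_list ns))\<lparr>carrier := tower ns\<rparr>"

lemma carrier_wreath_tower:
  "(p, f) \<in> carrier (wreath_sym (tower_group ns) n) \<longleftrightarrow>
     p permutes {1..n} \<and> f \<in> {1..n} \<rightarrow>\<^sub>E tower ns"
  by (simp add: wreath_sym_def sym_group_def)

lemma mult_wreath_tower:
  "(p, f) \<otimes>\<^bsub>wreath_sym (tower_group ns) n\<^esub> (q, g) =
     (p \<circ> q, \<lambda>i\<in>{1..n}. (\<lambda>i\<in>{1..n}. f (q i)) i \<circ> g i)"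
  by (simp add: wreath_sym_def sym_group_def)

lemma wreath_action_in_tower:
  assumes p: "p permutes {1..n}" and f: "f \<in> {1..n} \<rightarrow>\<^sub>E tower ns"
  shows "wreath_action (prod_list ns) n (p, f) \<in> tower (ns @ [n])"
proof -
  let ?m = "prod_list ns" and ?w = "wreath_action (prod_list ns) n (p, f)"
  have pb: "p b \<in> {1..n}" if "b \<in> {1..n}" for b
    using that by (simp only: permutes_in_image[OF p])
  have fb: "f b permutes {1..?m}" if "b \<in> {1..n}" for b
    by (rule tower_permutes[OF PiE_mem[OF f that]])
  have fa: "f b a \<in> {1..?m}" if "a \<in> {1..?m}" "b \<in> {1..n}" for a b
    using that by (simp only: permutes_in_image[OF fb])
  \<comment> \<open>Modulus 0, whose congruence is equality, is included to obtain injectivity from the same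
     computation.\<close>
  have modw: "?w i mod (d * n) = ?w k mod (d * n) \<longleftrightarrow> i mod (d * n) = k mod (d * n)"
    if d: "d \<in> insert 0 (moduli ns)" and i: "i \<in> {1..?m * n}" "k \<in> {1..?m * n}" for d i k
  proof -
    obtain a b where ab: "a \<in> {1..?m}" "b \<in> {1..n}" "i = cell n a b" using cell_cases[OF i(1)] .
    obtain a' b' where ab': "a' \<in> {1..?m}" "b' \<in> {1..n}" "k = cell n a' b'" using cell_cases[OF i(2)] .
    have "?w i mod (d * n) = ?w k mod (d * n) \<longleftrightarrow> p b = p b' \<and> f b a mod d = f b' a' mod d"
      using ab ab' fa[OF ab(1,2)] fa[OF ab'(1,2)] pb[OF ab(2)] pb[OF ab'(2)]
        cell_mod_eq_iff[of "f b a" "f b' a'" "p b" n "p b'" d]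
      by (simp add: wreath_action_cell)
    also have "\<dots> \<longleftrightarrow> b = b' \<and> a mod d = a' mod d"
    proof -
      have "p b = p b' \<longleftrightarrow> b = b'" using permutes_inj[OF p] by (simp add: inj_eq)
      moreover have "f b a mod d = f b a' mod d \<longleftrightarrow> a mod d = a' mod d"
      proof (cases "d = 0")
        case True
        then show ?thesis using permutes_inj[OF fb[OF ab(2)]] by (simp add: inj_eq)
      next
        case False
        then show ?thesis using tower_mod[OF PiE_mem[OF f ab(2)] _ ab(1) ab'(1)] d by simp
      qed
      ultimately show ?thesis by auto
    qed
    also have "\<dots> \<longleftrightarrow> i mod (d * n) = k mod (d * n)"
      using ab ab' cell_mod_eq_iff[of a a' b n b' d] by simp
    finally show ?thesis .
  qed
  have "?w permutes {1..?m * n}"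
  proof (rule permutes_if_inj_on)
    show "inj_on ?w {1..?m * n}" using modw[of 0] by (auto intro: inj_onI)
    show "?w ` {1..?m * n} \<subseteq> {1..?m * n}"
    proof
      fix j assume "j \<in> ?w ` {1..?m * n}"
      then obtain i where i: "i \<in> {1..?m * n}" "j = ?w i" by blast
      obtain a b where "a \<in> {1..?m}" "b \<in> {1..n}" "i = cell n a b" using cell_cases[OF i(1)] .
      then show "j \<in> {1..?m * n}"
        using i(2) wreath_action_cell cell_range[OF fa pb] by simp
    qed
  qed (auto simp: wreath_action_outside)
  then show ?thesis using modw by (auto simp: tower_def moduli_snoc)
qed

lemma wreath_action_mult:
  assumes x: "(p, f) \<in> carrier (wreath_sym (tower_group ns) n)"
    and y: "(q, g) \<in> carrier (wreath_sym (tower_group ns) n)"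
  shows "wreath_action (prod_list ns) n ((p, f) \<otimes>\<^bsub>wreath_sym (tower_group ns) n\<^esub> (q, g)) =
    wreath_action (prod_list ns) n (p, f) \<circ> wreath_action (prod_list ns) n (q, g)"
proof
  fix i
  let ?m = "prod_list ns"
  show "wreath_action ?m n ((p, f) \<otimes>\<^bsub>wreath_sym (tower_group ns) n\<^esub> (q, g)) i =
    (wreath_action ?m n (p, f) \<circ> wreath_action ?m n (q, g)) i"
  proof (cases "i \<in> {1..?m * n}")
    case True
    obtain a b where ab: "a \<in> {1..?m}" "b \<in> {1..n}" "i = cell n a b" using cell_cases[OF True] .
    have "q b \<in> {1..n}"
      using y ab(2) permutes_in_image[of q "{1..n}" b] by (simp add: carrier_wreath_tower)
    moreover have "g b a \<in> {1..?m}"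
    proof -
      have "g b permutes {1..?m}"
        using y ab(2) unfolding carrier_wreath_tower by (intro tower_permutes) blast
      then show ?thesis using ab(1) by (simp only: permutes_in_image)
    qed
    ultimately show ?thesis using ab unfolding mult_wreath_tower by (simp add: wreath_action_cell)
  qed (simp add: mult_wreath_tower wreath_action_outside)
qed

lemma wreath_action_inj:
  assumes "0 < prod_list ns"
  shows "inj_on (wreath_action (prod_list ns) n) (carrier (wreath_sym (tower_group ns) n))"
proof (rule inj_onI, clarify)
  let ?m = "prod_list ns"
  fix p f q g
  assume x: "(p, f) \<in> carrier (wreath_sym (tower_group ns) n)"
    and y: "(q, g) \<in> carrier (wreath_sym (tower_group ns) n)"
    and eq: "wreath_action ?m n (p, f) = wreath_action ?m n (q, g)"
  have p: "p permutes {1..n}" "q permutes {1..n}"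
    and f: "f \<in> {1..n} \<rightarrow>\<^sub>E tower ns" "g \<in> {1..n} \<rightarrow>\<^sub>E tower ns"
    using x y by (simp_all only: carrier_wreath_tower)
  have fb: "f b permutes {1..?m}" "g b permutes {1..?m}" if "b \<in> {1..n}" for b
    using tower_permutes[OF PiE_mem[OF f(1) that]] tower_permutes[OF PiE_mem[OF f(2) that]] .
  have same: "f b a = g b a \<and> p b = q b" if ab: "a \<in> {1..?m}" "b \<in> {1..n}" for a b
  proof -
    have "cell n (f b a) (p b) = cell n (g b a) (q b)"
      using arg_cong[OF eq, of "\<lambda>w. w (cell n a b)"] ab by (simp only: wreath_action_cell)
    moreover have "f b a \<in> {1..?m}" "g b a \<in> {1..?m}" "p b \<in> {1..n}" "q b \<in> {1..n}"
      using ab by (simp_all only: permutes_in_image[OF fb(1)] permutes_in_image[OF fb(2)]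
          permutes_in_image[OF p(1)] permutes_in_image[OF p(2)])
    ultimately show ?thesis using cell_eq_iff[of "f b a" "g b a" "p b" n "q b"] by simp
  qed
  have "p b = q b" for b
  proof (cases "b \<in> {1..n}")
    case True
    then show ?thesis using same[of 1 b] assms by simp
  next
    case False
    then show ?thesis using permutes_not_in[OF p(1)] permutes_not_in[OF p(2)] by simp
  qed
  moreover have "f = g"
  proof (rule PiE_ext[OF f], rule ext)
    fix b a assume b: "b \<in> {1..n}"
    show "f b a = g b a"
    proof (cases "a \<in> {1..?m}")
      case False
      then show ?thesis using permutes_not_in[OF fb(1)[OF b]] permutes_not_in[OF fb(2)[OF b]] by simp
    qed (use same b in blast)
  qed
  ultimately show "p = q \<and> f = g" by blast
qed

text \<open>
  A permutation in the tower of \<open>ns @ [n]\<close> respects congruence modulo \<open>n\<close>, because 1 is a modulus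
  of \<open>ns\<close>, and so permutes the columns. Reading off the column permutation in the first row and the
  row permutations column by column gives its preimage.
\<close>

lemma wreath_action_surj:
  assumes "ns \<noteq> []" "0 < prod_list ns" and P: "P \<in> tower (ns @ [n])"
  shows "P \<in> wreath_action (prod_list ns) n ` carrier (wreath_sym (tower_group ns) n)"
proof -
  let ?m = "prod_list ns"
  have perm: "P permutes {1..?m * n}" using tower_permutes[OF P] by simp
  have Pr: "P i \<in> {1..?m * n}" if "i \<in> {1..?m * n}" for i
    using that by (simp only: permutes_in_image[OF perm])
  have Pm: "P i mod (d * n) = P k mod (d * n) \<longleftrightarrow> i mod (d * n) = k mod (d * n)"
    if "d \<in> moduli ns" "i \<in> {1..?m * n}" "k \<in> {1..?m * n}" for d i k
  proof -
    have "d * n \<in> moduli (ns @ [n])" using that(1) unfolding moduli_snoc by blast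
    then show ?thesis using tower_mod[OF P, of "d * n" i k] that by simp
  qed
  have m: "1 \<in> {1..?m}" using assms(2) by simp
  define p where "p b = (if b \<in> {1..n} then residue n (P (cell n 1 b)) else b)" for b
  define f where "f = (\<lambda>b\<in>{1..n}. \<lambda>a. if a \<in> {1..?m} then row n (P (cell n a b)) else a)"
  have res: "residue n (P (cell n a b)) = residue n (P (cell n a' b')) \<longleftrightarrow> b = b'"
    if "a \<in> {1..?m}" "b \<in> {1..n}" "a' \<in> {1..?m}" "b' \<in> {1..n}" for a b a' b'
    using Pm[OF one_in_moduli[OF assms(1)] cell_range cell_range, of a b a' b'] that
      Pr[OF cell_range[of a ?m b n]] Pr[OF cell_range[of a' ?m b' n]]
      cell_mod_eq_iff[of a a' b n b' 1]
    by (simp add: residue_eq_iff)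
  have P_cell: "P (cell n a b) = cell n (f b a) (p b)" if "a \<in> {1..?m}" "b \<in> {1..n}" for a b
    using that res[OF that m that(2)] cell_row_residue[of "P (cell n a b)" n] Pr[OF cell_range[OF that]]
    by (simp add: f_def p_def)
  have fr: "f b a \<in> {1..?m}" if "a \<in> {1..?m}" "b \<in> {1..n}" for a b
    using row_range[OF Pr[OF cell_range[OF that]]] that by (simp add: f_def)
  have pr: "p b \<in> {1..n}" if "b \<in> {1..n}" for b
    using that residue_range[of n] by (auto simp: p_def)
  have p: "p permutes {1..n}"
  proof (rule permutes_if_inj_on)
    show "inj_on p {1..n}" using res[OF m _ m] by (auto intro: inj_onI simp: p_def)
    show "p ` {1..n} \<subseteq> {1..n}" using pr by blast
  qed (simp_all only: p_def finite_atLeastAtMost if_False)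
  have f_tower: "f b \<in> tower ns" if b: "b \<in> {1..n}" for b
  proof -
    have fm: "f b a mod d = f b a' mod d \<longleftrightarrow> a mod d = a' mod d"
      if d: "d \<in> moduli ns" and a: "a \<in> {1..?m}" "a' \<in> {1..?m}" for d a a'
      using Pm[OF d cell_range[OF a(1) b] cell_range[OF a(2) b]] P_cell[OF a(1) b] P_cell[OF a(2) b]
        cell_mod_eq_iff[of a a' b n b d] cell_mod_eq_iff[of "f b a" "f b a'" "p b" n "p b" d]
        a b fr[OF a(1) b] fr[OF a(2) b] pr[OF b]
      by simp
    have "f b permutes {1..?m}"
    proof (rule permutes_if_inj_on)
      show "f b ` {1..?m} \<subseteq> {1..?m}" using fr b by blast
      show "inj_on (f b) {1..?m}"
      proof (rule inj_onI)
        fix a a' assume a: "a \<in> {1..?m}" "a' \<in> {1..?m}" "f b a = f b a'"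
        then have "P (cell n a b) = P (cell n a' b)" using P_cell b by simp
        then have "cell n a b = cell n a' b" using permutes_inj[OF perm] by (simp add: inj_eq)
        then show "a = a'" using a b by (simp add: cell_eq_iff)
      qed
    qed (use b in \<open>simp_all only: f_def finite_atLeastAtMost restrict_apply' if_False\<close>)
    then show ?thesis using fm by (simp add: tower_def)
  qed
  have "wreath_action ?m n (p, f) i = P i" for i
  proof (cases "i \<in> {1..?m * n}")
    case True
    obtain a b where "a \<in> {1..?m}" "b \<in> {1..n}" "i = cell n a b" using cell_cases[OF True] .
    then show ?thesis using P_cell by (simp add: wreath_action_cell)
  next
    case False
    then show ?thesis using permutes_not_in[OF perm] by (simp add: wreath_action_outside)
  qed
  then have "P = wreath_action ?m n (p, f)" by (simp add: fun_eq_iff)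
  moreover have "(p, f) \<in> carrier (wreath_sym (tower_group ns) n)"
    using p f_tower by (auto simp: carrier_wreath_tower f_def)
  ultimately show ?thesis by blast
qed

lemma wreath_tower_iso:
  assumes "ns \<noteq> []" "0 < prod_list ns"
  shows "wreath_sym (tower_group ns) n \<cong> tower_group (ns @ [n])"
proof -
  have "wreath_action (prod_list ns) n \<in> iso (wreath_sym (tower_group ns) n) (tower_group (ns @ [n]))"
  proof (rule isoI)
    show "wreath_action (prod_list ns) n \<in> hom (wreath_sym (tower_group ns) n) (tower_group (ns @ [n]))"
    proof (rule homI)
      fix x assume "x \<in> carrier (wreath_sym (tower_group ns) n)"
      then show "wreath_action (prod_list ns) n x \<in> carrier (tower_group (ns @ [n]))"
        using wreath_action_in_tower[of "fst x" n "snd x" ns] carrier_wreath_tower[of "fst x" "snd x"]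
        by simp
    next
      fix x y
      assume "x \<in> carrier (wreath_sym (tower_group ns) n)" "y \<in> carrier (wreath_sym (tower_group ns) n)"
      then show "wreath_action (prod_list ns) n (x \<otimes>\<^bsub>wreath_sym (tower_group ns) n\<^esub> y) =
          wreath_action (prod_list ns) n x \<otimes>\<^bsub>tower_group (ns @ [n])\<^esub> wreath_action (prod_list ns) n y"
        using wreath_action_mult[of "fst x" "snd x" ns n "fst y" "snd y"] by (simp add: sym_group_mult)
    qed
    show "bij_betw (wreath_action (prod_list ns) n)
        (carrier (wreath_sym (tower_group ns) n)) (carrier (tower_group (ns @ [n])))"
      unfolding bij_betw_def
    proof (intro conjI equalityI subsetI)
      fix P assume "P \<in> wreath_action (prod_list ns) n ` carrier (wreath_sym (tower_group ns) n)"
      then show "P \<in> carrier (tower_group (ns @ [n]))"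
        using wreath_action_in_tower by (auto simp: carrier_wreath_tower)
    qed (use wreath_action_inj wreath_action_surj assms in auto)
  qed
  then show ?thesis by (auto simp: is_iso_def)
qed

lemma wreath_sym_iso:
  assumes "H \<cong> K"
  shows "wreath_sym H n \<cong> wreath_sym K n"
proof -
  obtain h where hom: "h \<in> hom H K" and bij: "bij_betw h (carrier H) (carrier K)"
    using assms by (auto simp: is_iso_def iso_def)
  define k where "k = inv_into (carrier H) h"
  define F where "F = (\<lambda>(p :: nat \<Rightarrow> nat, f). (p, \<lambda>i\<in>{1..n}. h (f i)))"
  define F' where "F' = (\<lambda>(p :: nat \<Rightarrow> nat, f). (p, \<lambda>i\<in>{1..n}. k (f i)))"
  have kh: "k (h x) = x" if "x \<in> carrier H" for x
    using bij that by (simp add: k_def bij_betw_def)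
  have hk: "h (k y) = y" and k: "k y \<in> carrier H" if "y \<in> carrier K" for y
    using bij that f_inv_into_f[of y h "carrier H"] inv_into_into[of y h "carrier H"]
    by (auto simp: k_def bij_betw_def)
  have h: "h x \<in> carrier K" if "x \<in> carrier H" for x
    using hom that by (auto simp: hom_def)
  have "F \<in> iso (wreath_sym H n) (wreath_sym K n)"
  proof (rule isoI)
    show "F \<in> hom (wreath_sym H n) (wreath_sym K n)"
    proof (rule homI)
      fix x y assume xy: "x \<in> carrier (wreath_sym H n)" "y \<in> carrier (wreath_sym H n)"
      obtain p f q g where x: "x = (p, f)" and y: "y = (q, g)" by fastforce
      have q: "q i \<in> {1..n}" if "i \<in> {1..n}" for i
        using xy that by (simp add: y wreath_sym_def sym_group_carrier permutes_in_image del: atLeastAtMost_iff)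
      have "h (f (q i) \<otimes>\<^bsub>H\<^esub> g i) = h (f (q i)) \<otimes>\<^bsub>K\<^esub> h (g i)" if "i \<in> {1..n}" for i
        using xy q[OF that] that hom
        by (intro hom_mult) (auto simp: x y wreath_sym_def simp del: atLeastAtMost_iff)
      then show "F (x \<otimes>\<^bsub>wreath_sym H n\<^esub> y) = F x \<otimes>\<^bsub>wreath_sym K n\<^esub> F y"
        using q by (auto simp: x y F_def wreath_sym_def fun_eq_iff simp del: atLeastAtMost_iff)
    qed (use h in \<open>auto simp: F_def wreath_sym_def PiE_def Pi_iff\<close>)
    show "bij_betw F (carrier (wreath_sym H n)) (carrier (wreath_sym K n))"
      by (rule bij_betw_byWitness[of _ F'])
        (use h k hk kh in \<open>auto simp: F_def F'_def wreath_sym_def fun_eq_iff PiE_def extensional_def Pi_iff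
           simp del: atLeastAtMost_iff\<close>)
  qed
  then show ?thesis by (auto simp: is_iso_def)
qed

lemma code_Aut_eq_tower_group:
  "word_perms (prod_list ns) C = tower ns \<Longrightarrow> code_Aut (prod_list ns) C = tower_group ns"
  using carrier_code_Aut[of "prod_list ns" C] by (simp add: code_Aut_def)

text \<open>
  Closure under composition and inverses comes for free from a code with this automorphism group.
\<close>

lemma tower_group_is_group:
  assumes "\<forall>n\<in>set ns. 3 \<le> n"
  shows "group (tower_group ns)"
proof -
  obtain C where C: "linear_code (prod_list ns) C" "word_perms (prod_list ns) C = tower ns"
    using code_pair_exists[OF assms] by blast
  have "subgroup (tower ns) (sym_group (prod_list ns))"
    using code_Aut_is_subgroup[OF C(1)] C(2) by (simp only: carrier_code_Aut)
  then show ?thesis by (rule subgroup.subgroup_is_group[OF _ sym_group_is_group])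
qed

text \<open>
  The code is built by adding innermost factors at the head of the list, whereas
  \<^const>\<open>iterated_wreath\<close> adds top factors at its end. The explicit description by congruences
  allows both readings, which takes the place of the associativity of the wreath product.
\<close>

lemma tower_group_iso_iterated_wreath:
  assumes "ns \<noteq> []" "\<forall>n\<in>set ns. 3 \<le> n"
  shows "tower_group ns \<cong> iterated_wreath ns"
  using assms
proof (induction ns rule: rev_nonempty_induct)
  case (single n)
  have "tower [n] = carrier (sym_group n)" by (auto simp: tower_def sym_group_def)
  then have "tower_group [n] = sym_group n" by simp
  then show ?case using iterated_wreath_single by simp
next
  case (snoc n ns)
  have pos: "0 < prod_list ns" using snoc.prems by (intro prod_list_pos) auto
  have iso: "wreath_sym (tower_group ns) n \<cong> tower_group (ns @ [n])"
    by (rule wreath_tower_iso[OF snoc.hyps(1) pos])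
  have "group (tower_group ns)"
    using snoc.prems by (intro tower_group_is_group) auto
  then have "tower_group (ns @ [n]) \<cong> wreath_sym (tower_group ns) n"
    using group.iso_sym[OF wreath_sym_is_group iso] by blast
  also have "wreath_sym (tower_group ns) n \<cong> wreath_sym (iterated_wreath ns) n"
    using snoc by (intro wreath_sym_iso) auto
  also have "\<dots> \<cong> iterated_wreath (ns @ [n])"
    by (rule iterated_wreath_snoc[OF snoc.hyps(1)])
  finally show ?case .
qed

theorem theorem3:
  fixes ns :: "nat list"
  assumes "ns \<noteq> []"
    and "\<forall>n\<in>set ns. odd n \<and> 3 \<le> n"
  shows "\<exists>C. cyclic_code (prod_list ns) C \<and> code_Aut (prod_list ns) C \<cong> iterated_wreath ns"
proof -
  let ?N = "prod_list ns"
  have ge3: "\<forall>n\<in>set ns. 3 \<le> n" using assms(2) by blast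
  obtain C where C: "linear_code ?N C" "word_perms ?N C = tower ns"
    using code_pair_exists[OF ge3] by blast
  have "cycle [1..<Suc ?N]" "set [1..<Suc ?N] = {1..?N}"
    by (auto simp del: upt_Suc)
  moreover have "cycle_of_list [1..<Suc ?N] \<in> carrier (code_Aut ?N C)"
    using cycle_in_tower by (simp only: carrier_code_Aut C(2))
  ultimately have "cyclic_code ?N C" using C(1) unfolding cyclic_code_def by blast
  moreover have "code_Aut ?N C \<cong> iterated_wreath ns"
    using tower_group_iso_iterated_wreath[OF assms(1) ge3] code_Aut_eq_tower_group[OF C(2)] by simp
  ultimately show ?thesis by blast
qed

end
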